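(* Let $\mu$ be a Borel probability measure on $\mathbb R^1$ such that $\mu*\mu\in L^\infty(\mathbb R^1)$. Then for every $p$ with $1\le p\le 4/3$ there is a constant $C>0$, independent of $f$, such that $$\|\hat f\|_{L^2(\mu)}\le C\,\|f\|_{L^p(\mathbb R^1)}\qquad\text{for all } f\in\mathcal S(\mathbb R^1).$$
   Context: $\mathcal S(\mathbb R^1)$ is the Schwartz space and $\hat f(\xi)=\int_{\mathbb R}e^{-2\pi i \xi x}f(x)\,dx$. The hypothesis $\mu*\mu\in L^\infty(\mathbb R^1)$ means that the convolution $\mu*\mu$ is absolutely continuous with respect to Lebesgue measure, with essentially bounded density. *)

theory Defs
  imports "HOL-Probability.Probability"
begin

definition iterated_deriv :: "nat \<Rightarrow> (real \<Rightarrow> complex) \<Rightarrow> real \<Rightarrow> complex" where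
  "iterated_deriv n f = ((\<lambda>g x. vector_derivative g (at x)) ^^ n) f"

definition schwartz_space :: "(real \<Rightarrow> complex) set" where
  "schwartz_space =
     {f. (\<forall>n x. iterated_deriv n f differentiable (at x)) \<and>
         (\<forall>m n. bounded (range (\<lambda>x. x ^ m *\<^sub>R iterated_deriv n f x)))}"

definition fourier_transform :: "(real \<Rightarrow> complex) \<Rightarrow> real \<Rightarrow> complex" where
  "fourier_transform f \<xi> =
     (LINT x|lborel. exp (- 2 * complex_of_real pi * \<i> * complex_of_real \<xi> * complex_of_real x) * f x)"

text \<open>The norm takes values in the extended nonnegative reals, so that a function whose
  \<open>p\<close>-th power is not integrable has norm \<open>\<infinity>\<close>. It is intended for measurable
  \<open>f\<close> and \<open>0 < p < \<infinity>\<close>.\<close>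

definition Lp_norm :: "'a measure \<Rightarrow> real \<Rightarrow> ('a \<Rightarrow> complex) \<Rightarrow> ennreal" where
  "Lp_norm M p f =
     (let I = (\<integral>\<^sup>+ x. ennreal (norm (f x) powr p) \<partial>M)
      in if I = \<infinity> then \<infinity> else ennreal (enn2real I powr (1 / p)))"

definition has_Linfty_density :: "real measure \<Rightarrow> bool" where
  "has_Linfty_density \<nu> \<longleftrightarrow>
     (\<exists>g :: real \<Rightarrow> ennreal. g \<in> borel_measurable lborel \<and> esssup lborel g < \<infinity> \<and>
        \<nu> = density lborel g)"

end

theory Submission
  imports Defs
begin

text \<open>By duality, the estimate is a bound for the extension operator
  \<open>H x = \<integral> g(a) exp(-2\<pi>i a x) d\<mu>(a)\<close> from \<open>L\<^sup>2(\<mu>)\<close> to \<open>L\<^sup>q\<close>, where \<open>q \<ge> 4\<close> is conjugate to \<open>p\<close>.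
  Since \<open>\<mu>\<close> is a probability measure, \<open>\<bar>H\<bar> \<le> \<parallel>g\<parallel>\<^sub>2\<close>, so \<open>q = 4\<close> suffices. Now \<open>H\<^sup>2\<close> is the Fourier transform of
  the image of \<open>g(a) g(b) \<mu>(da) \<mu>(db)\<close> under addition. Its \<open>L\<^sup>2\<close> norm against the weight
  \<open>exp(-x\<^sup>2 / 2\<sigma>\<^sup>2)\<close> is a quadratic form with a Gaussian kernel in \<open>a + b - c - d\<close>. The integral of
  this kernel in \<open>(c, d)\<close> is controlled by the density of \<open>\<mu> * \<mu>\<close>, so Schur's test bounds the
  form uniformly in \<open>\<sigma>\<close>, and \<open>\<sigma> \<rightarrow> \<infinity>\<close> gives
  \<open>\<parallel>H\<parallel>\<^sub>4\<^sup>4 \<le> \<parallel>\<mu> * \<mu>\<parallel>\<^sub>\<infinity> \<parallel>g\<parallel>\<^sub>2\<^sup>4\<close>.\<close>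

section \<open>Measurability, the mass of the Gaussian kernel, and Schur's test\<close>

lemma borel_measurable_cis [measurable]: "cis \<in> borel_measurable borel"
  by (intro borel_measurable_continuous_onI) (auto intro!: continuous_intros)

lemma borel_measurable_cnj [measurable]: "cnj \<in> borel_measurable borel"
  by (intro borel_measurable_continuous_onI) (auto intro!: continuous_intros)

text \<open>As a function of \<open>t\<close> the kernel is a multiple of the normal density with
  mean \<open>s\<close> and standard deviation \<open>1 / (2 * pi * \<sigma>)\<close>. That density
  has mass one, so the integral is the multiple itself.\<close>

lemma nn_integral_gaussian_kernel:
  fixes \<sigma> s :: real
  assumes "\<sigma> > 0"
  shows "(\<integral>\<^sup>+ t. ennreal (exp (- (2 * pi * \<sigma> * (t - s))\<^sup>2 / 2)) \<partial>lborel)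
    = ennreal (1 / (\<sigma> * sqrt (2 * pi)))"
proof -
  let ?\<tau> = "1 / (2 * pi * \<sigma>)"
  interpret N: prob_space "density lborel (normal_density s ?\<tau>)"
    using assms by (intro prob_space_normal_density) simp
  have mass: "(\<integral>\<^sup>+ t. ennreal (normal_density s ?\<tau> t) \<partial>lborel) = 1"
    using N.emeasure_space_1 by (simp add: emeasure_density)
  have root: "sqrt (2 * pi * ?\<tau>\<^sup>2) = 1 / (\<sigma> * sqrt (2 * pi))"
    using assms by (simp add: real_sqrt_mult real_sqrt_divide power2_eq_square field_simps)
  have eq: "exp (- (2 * pi * \<sigma> * (t - s))\<^sup>2 / 2) = 1 / (\<sigma> * sqrt (2 * pi)) * normal_density s ?\<tau> t" for t
    unfolding normal_density_def root using assms by (simp add: power2_eq_square field_simps)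
  have "ennreal (exp (- (2 * pi * \<sigma> * (t - s))\<^sup>2 / 2))
      = ennreal (1 / (\<sigma> * sqrt (2 * pi))) * ennreal (normal_density s ?\<tau> t)" for t
    unfolding eq using assms by (intro ennreal_mult') simp
  then show ?thesis
    by (simp add: nn_integral_cmult mass)
qed

text \<open>By \<open>2 * (a z * a w) \<le> (a z)\<^sup>2 + (a w)\<^sup>2\<close> the form splits
  into two terms. Symmetry of \<open>K\<close> and Tonelli make them equal, and in each one the
  inner integral is a row integral of \<open>K\<close>, at most \<open>c\<close>. Working in
  \<open>ennreal\<close> avoids integrability side conditions.\<close>

lemma schur_test_symmetric:
  fixes a :: "'a \<Rightarrow> real" and K :: "'a \<Rightarrow> 'a \<Rightarrow> ennreal"
  assumes "sigma_finite_measure Q"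
    and [measurable]: "a \<in> borel_measurable Q" "case_prod K \<in> borel_measurable (Q \<Otimes>\<^sub>M Q)"
    and nonneg: "\<And>z. 0 \<le> a z"
    and sym: "\<And>z w. K z w = K w z"
    and bound: "\<And>z. z \<in> space Q \<Longrightarrow> (\<integral>\<^sup>+ w. K z w \<partial>Q) \<le> c"
  shows "(\<integral>\<^sup>+ z. \<integral>\<^sup>+ w. ennreal (a z * a w) * K z w \<partial>Q \<partial>Q) \<le> c * (\<integral>\<^sup>+ z. ennreal ((a z)\<^sup>2) \<partial>Q)"
proof -
  interpret sigma_finite_measure Q by fact
  interpret pair_sigma_finite Q Q ..
  let ?I = "\<integral>\<^sup>+ z. ennreal ((a z)\<^sup>2) \<partial>Q"
  let ?S = "\<integral>\<^sup>+ z. \<integral>\<^sup>+ w. ennreal ((a z)\<^sup>2) * K z w \<partial>Q \<partial>Q"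
  have S: "?S \<le> c * ?I"
  proof -
    have "?S = (\<integral>\<^sup>+ z. ennreal ((a z)\<^sup>2) * (\<integral>\<^sup>+ w. K z w \<partial>Q) \<partial>Q)"
      by (intro nn_integral_cong nn_integral_cmult) measurable
    also have "\<dots> \<le> (\<integral>\<^sup>+ z. ennreal ((a z)\<^sup>2) * c \<partial>Q)"
      by (intro nn_integral_mono mult_left_mono bound) auto
    also have "\<dots> = c * ?I"
      by (simp add: nn_integral_multc mult.commute[of c])
    finally show ?thesis .
  qed
  have swap: "(\<integral>\<^sup>+ z. \<integral>\<^sup>+ w. ennreal ((a w)\<^sup>2) * K z w \<partial>Q \<partial>Q) = ?S"
    by (subst Fubini') (auto simp: sym)
  have young: "2 * (ennreal (a z * a w) * K z w) \<le> ennreal ((a z)\<^sup>2) * K z w + ennreal ((a w)\<^sup>2) * K z w" for z w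
  proof -
    have "2 * (a z * a w) \<le> (a z)\<^sup>2 + (a w)\<^sup>2"
      using sum_squares_bound[of "a z" "a w"] by (simp add: mult.assoc)
    then have "2 * ennreal (a z * a w) \<le> ennreal ((a z)\<^sup>2) + ennreal ((a w)\<^sup>2)"
      using nonneg by (simp add: ennreal_mult'[symmetric] ennreal_numeral[symmetric] ennreal_plus[symmetric] del: ennreal_plus ennreal_numeral)
    from mult_right_mono[OF this, of "K z w"] show ?thesis
      by (simp add: distrib_right mult.assoc)
  qed
  have "2 * (\<integral>\<^sup>+ z. \<integral>\<^sup>+ w. ennreal (a z * a w) * K z w \<partial>Q \<partial>Q)
      = (\<integral>\<^sup>+ z. \<integral>\<^sup>+ w. 2 * (ennreal (a z * a w) * K z w) \<partial>Q \<partial>Q)"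
    by (subst nn_integral_cmult[symmetric], measurable)
      (intro nn_integral_cong nn_integral_cmult[symmetric], measurable)
  also have "\<dots> \<le> (\<integral>\<^sup>+ z. \<integral>\<^sup>+ w. ennreal ((a z)\<^sup>2) * K z w + ennreal ((a w)\<^sup>2) * K z w \<partial>Q \<partial>Q)"
    by (intro nn_integral_mono young)
  also have "\<dots> = ?S + ?S"
    by (subst (2) swap[symmetric]) (simp add: nn_integral_add cong: nn_integral_cong_simp)
  also have "\<dots> \<le> 2 * (c * ?I)"
    using add_mono[OF S S] by (simp add: mult_2)
  finally show ?thesis
    by (subst (asm) ennreal_mult_le_mult_iff) auto
qed

section \<open>Gaussian-weighted and unweighted L^2 bounds for the extension operator\<close>

lemma integral_cis_std_normal:
  "(LINT x|std_normal_distribution. cis (t * x)) = complex_of_real (exp (- t\<^sup>2 / 2))"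
  using fun_cong[OF char_std_normal_distribution, of t] by (simp add: char_def cis_conv_exp)

text \<open>\<open>F\<close> is the Fourier transform of the image under \<open>\<phi>\<close> of
  the complex measure with \<open>Q\<close>-density \<open>G\<close>. Averaging
  \<open>\<bar>F\<bar>\<^sup>2\<close> over a Gaussian turns the phases into a positive kernel, to
  which Schur's test applies. The bound \<open>B\<close> justifies Fubini. The abstract pair
  \<open>Q\<close>, \<open>\<phi>\<close> is later the product measure with addition.\<close>

lemma extension_gaussian_L2_bound:
  fixes \<phi> :: "'a \<Rightarrow> real" and G :: "'a \<Rightarrow> complex" and M B \<sigma> :: real
  assumes Q: "prob_space Q"
    and [measurable]: "\<phi> \<in> borel_measurable Q" "G \<in> borel_measurable Q" "h \<in> borel_measurable lborel"
    and B: "\<And>z. norm (G z) \<le> B"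
    and dens: "distr Q borel \<phi> = density lborel h"
    and h: "AE x in lborel. h x \<le> ennreal M"
    and \<sigma>: "\<sigma> > 0"
  defines "F \<equiv> \<lambda>x. LINT z|Q. G z * cis (- (2 * pi * \<phi> z * x))"
  shows "(\<integral>\<^sup>+ x. ennreal ((norm (F (\<sigma> * x)))\<^sup>2) \<partial>std_normal_distribution)
     \<le> ennreal (1 / (\<sigma> * sqrt (2 * pi))) * ennreal M * (\<integral>\<^sup>+ z. ennreal ((norm (G z))\<^sup>2) \<partial>Q)"
proof -
  interpret Q: prob_space Q by fact
  interpret N: prob_space std_normal_distribution
    by (intro prob_space_normal_density) simp
  interpret QQ: pair_prob_space Q Q ..
  interpret NQQ: pair_prob_space std_normal_distribution "Q \<Otimes>\<^sub>M Q" ..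
  have setsN[measurable_cong]: "sets std_normal_distribution = sets borel" by simp
  \<comment> \<open>This is the characteristic function of the standard normal law at
    \<open>2 * pi * \<sigma> * (\<phi> w - \<phi> z)\<close>.\<close>
  define K where "K z w = exp (- (2 * pi * \<sigma> * (\<phi> w - \<phi> z))\<^sup>2 / 2)" for z w
  have Kmeas[measurable]: "case_prod K \<in> borel_measurable (Q \<Otimes>\<^sub>M Q)"
    unfolding K_def by measurable
  \<comment> \<open>The integrand of \<open>F (\<sigma> * x) * cnj (F (\<sigma> * x))\<close>
    written as one integral over pairs; the conjugation produces the difference of phases.\<close>
  define E where "E x zw = G (fst zw) * cnj (G (snd zw)) * cis (2 * pi * \<sigma> * (\<phi> (snd zw) - \<phi> (fst zw)) * x)" for x zw
  have B0: "0 \<le> B" using B order_trans norm_ge_zero by blast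
  have GG: "norm (G z * cnj (G w)) \<le> B * B" for z w
    using mult_mono[OF B[of z] B[of w]] B0 by (simp add: norm_mult)
  have Eint: "integrable (std_normal_distribution \<Otimes>\<^sub>M (Q \<Otimes>\<^sub>M Q)) (case_prod E)"
    unfolding E_def
    by (rule NQQ.P.integrable_const_bound[where B="B * B"]) (use GG in \<open>auto simp: norm_mult\<close>)
  have Gint: "integrable Q (\<lambda>z. G z * cis (- (2 * pi * \<phi> z * x)))" for x
    by (rule Q.integrable_const_bound[where B=B]) (use B in \<open>auto simp: norm_mult\<close>)
  have FE: "complex_of_real ((norm (F (\<sigma> * x)))\<^sup>2) = (LINT zw|(Q \<Otimes>\<^sub>M Q). E x zw)" for x
  proof -
    let ?g = "\<lambda>z. G z * cis (- (2 * pi * \<phi> z * (\<sigma> * x)))"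
    have "(LINT zw|(Q \<Otimes>\<^sub>M Q). E x zw) = (LINT z|Q. LINT w|Q. E x (z, w))"
      by (intro QQ.integral_fst'[symmetric] QQ.P.integrable_const_bound[where B="B * B"])
        (use GG in \<open>auto simp: norm_mult E_def\<close>)
    also have "\<dots> = (LINT z|Q. LINT w|Q. ?g z * cnj (?g w))"
      unfolding E_def by (intro Bochner_Integration.integral_cong refl)
        (simp add: cis_cnj mult.assoc mult.left_commute[of "cis _" "cnj _"] cis_mult, simp add: algebra_simps)
    also have "\<dots> = F (\<sigma> * x) * cnj (F (\<sigma> * x))"
      unfolding F_def by (simp only: Bochner_Integration.integral_cnj integral_mult_right_zero integral_mult_left_zero)
    finally show ?thesis by (simp only: complex_norm_square)
  qed
  have Fmeas[measurable]: "(\<lambda>x. F (\<sigma> * x)) \<in> borel_measurable borel"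
    unfolding F_def by measurable
  have Fbd: "norm (F x) \<le> B" for x
  proof -
    have "norm (F x) \<le> (LINT z|Q. norm (G z * cis (- (2 * pi * \<phi> z * x))))"
      unfolding F_def by (rule integral_norm_bound)
    also have "\<dots> \<le> B"
      by (intro Q.integral_le_const integrable_norm Gint) (use B in \<open>auto simp: norm_mult\<close>)
    finally show ?thesis .
  qed
  have "complex_of_real (LINT x|std_normal_distribution. (norm (F (\<sigma> * x)))\<^sup>2)
     = (LINT x|std_normal_distribution. LINT zw|(Q \<Otimes>\<^sub>M Q). E x zw)"
    unfolding FE[symmetric] by (rule integral_complex_of_real[symmetric])
  also have "\<dots> = (LINT zw|(Q \<Otimes>\<^sub>M Q). LINT x|std_normal_distribution. E x zw)"
    by (rule NQQ.Fubini_integral[OF Eint, symmetric])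
  also have "\<dots> = (LINT zw|(Q \<Otimes>\<^sub>M Q). G (fst zw) * cnj (G (snd zw)) * complex_of_real (K (fst zw) (snd zw)))"
    unfolding E_def K_def by (simp add: integral_cis_std_normal)
  finally have eq: "complex_of_real (LINT x|std_normal_distribution. (norm (F (\<sigma> * x)))\<^sup>2) = \<dots>" .
  have K01: "0 \<le> K z w" "K z w \<le> 1" for z w by (auto simp: K_def)
  have GK: "norm (G z) * norm (G w) * K z w \<le> B * B * 1" for z w
    by (intro mult_mono B K01) (auto intro: B0)
  have "(\<integral>\<^sup>+ x. ennreal ((norm (F (\<sigma> * x)))\<^sup>2) \<partial>std_normal_distribution)
      = ennreal (LINT x|std_normal_distribution. (norm (F (\<sigma> * x)))\<^sup>2)"
    by (intro nn_integral_eq_integral N.integrable_const_bound[where B="B\<^sup>2"])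
      (auto intro!: power_mono Fbd)
  \<comment> \<open>The left side is nonnegative, hence equal to its norm; the norm can then be
    moved inside the double integral, which leaves a form in \<open>norm (G z)\<close> with the
    positive kernel \<open>K\<close>.\<close>
  also have "(LINT x|std_normal_distribution. (norm (F (\<sigma> * x)))\<^sup>2)
      = norm (LINT zw|(Q \<Otimes>\<^sub>M Q). G (fst zw) * cnj (G (snd zw)) * complex_of_real (K (fst zw) (snd zw)))"
    unfolding eq[symmetric] norm_of_real by simp
  also have "ennreal \<dots> \<le> (\<integral>\<^sup>+ zw. ennreal (norm (G (fst zw) * cnj (G (snd zw)) * complex_of_real (K (fst zw) (snd zw)))) \<partial>(Q \<Otimes>\<^sub>M Q))"
    by (intro integral_norm_bound_ennreal QQ.P.integrable_const_bound[where B="B * B"])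
      (use GK K01 in \<open>auto simp: norm_mult\<close>)
  also have "\<dots> = (\<integral>\<^sup>+ z. \<integral>\<^sup>+ w. ennreal (norm (G z) * norm (G w)) * ennreal (K z w) \<partial>Q \<partial>Q)"
    by (subst Q.nn_integral_fst[symmetric])
      (auto simp: norm_mult K01 ennreal_mult mult.assoc)
  also have "\<dots> \<le> (ennreal (1 / (\<sigma> * sqrt (2 * pi))) * ennreal M) * (\<integral>\<^sup>+ z. ennreal ((norm (G z))\<^sup>2) \<partial>Q)"
  proof (rule schur_test_symmetric)
    fix z
    let ?k = "\<lambda>t. ennreal (exp (- (2 * pi * \<sigma> * (t - \<phi> z))\<^sup>2 / 2))"
    \<comment> \<open>The density hypothesis enters here: a row integral of \<open>K\<close> depends
      only on the law of \<open>\<phi>\<close>, so it is at most \<open>M\<close> times the mass of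
      the Gaussian kernel.\<close>
    have "(\<integral>\<^sup>+ w. ennreal (K z w) \<partial>Q) = (\<integral>\<^sup>+ t. ?k t \<partial>distr Q borel \<phi>)"
      unfolding K_def by (subst nn_integral_distr) auto
    also have "\<dots> = (\<integral>\<^sup>+ t. h t * ?k t \<partial>lborel)"
      unfolding dens by (subst nn_integral_density) auto
    also have "\<dots> \<le> (\<integral>\<^sup>+ t. ennreal M * ?k t \<partial>lborel)"
      using h by (intro nn_integral_mono_AE) (auto elim!: eventually_mono intro!: mult_right_mono)
    also have "\<dots> = ennreal M * ennreal (1 / (\<sigma> * sqrt (2 * pi)))"
      by (subst nn_integral_cmult) (measurable, simp only: nn_integral_gaussian_kernel[OF \<sigma>])
    finally show "(\<integral>\<^sup>+ w. ennreal (K z w) \<partial>Q) \<le> ennreal (1 / (\<sigma> * sqrt (2 * pi))) * ennreal M"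
      by (simp add: mult.commute)
  next
    show "ennreal (K z w) = ennreal (K w z)" for z w
      unfolding K_def power_mult_distrib by (simp only: power2_commute[of "\<phi> w" "\<phi> z"])
  qed (auto simp: Q.sigma_finite_measure_axioms)
  finally show ?thesis .
qed

text \<open>Rescaling by \<open>\<sigma>\<close> turns the standard normal average into an integral
  against a Gaussian weight of width \<open>\<sigma>\<close>. The resulting bound does not depend on
  \<open>\<sigma>\<close>, so Fatou's lemma removes the weight as the width tends to
  infinity.\<close>

lemma extension_L2_bound:
  fixes \<phi> :: "'a \<Rightarrow> real" and G :: "'a \<Rightarrow> complex" and M B :: real
  assumes Q: "prob_space Q"
    and [measurable]: "\<phi> \<in> borel_measurable Q" "G \<in> borel_measurable Q" "h \<in> borel_measurable lborel"
    and B: "\<And>z. norm (G z) \<le> B"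
    and dens: "distr Q borel \<phi> = density lborel h"
    and h: "AE x in lborel. h x \<le> ennreal M"
  defines "F \<equiv> \<lambda>x. LINT z|Q. G z * cis (- (2 * pi * \<phi> z * x))"
  shows "(\<integral>\<^sup>+ x. ennreal ((norm (F x))\<^sup>2) \<partial>lborel) \<le> ennreal M * (\<integral>\<^sup>+ z. ennreal ((norm (G z))\<^sup>2) \<partial>Q)"
proof -
  interpret Q: prob_space Q by fact
  have Fmeas[measurable]: "F \<in> borel_measurable borel"
    unfolding F_def by measurable
  let ?R = "ennreal M * (\<integral>\<^sup>+ z. ennreal ((norm (G z))\<^sup>2) \<partial>Q)"
  define w where "w \<sigma> x = exp (- (x / \<sigma>)\<^sup>2 / 2)" for \<sigma> x :: real
  have [measurable]: "w \<sigma> \<in> borel_measurable borel" for \<sigma>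
    unfolding w_def by measurable
  have le: "(\<integral>\<^sup>+ x. ennreal (w \<sigma> x * (norm (F x))\<^sup>2) \<partial>lborel) \<le> ?R" if \<sigma>: "\<sigma> > 0" for \<sigma>
  proof -
    have "(\<integral>\<^sup>+ x. ennreal (w \<sigma> x * (norm (F x))\<^sup>2) \<partial>lborel)
       = ennreal \<sigma> * (\<integral>\<^sup>+ y. ennreal (w \<sigma> (\<sigma> * y) * (norm (F (\<sigma> * y)))\<^sup>2) \<partial>lborel)"
      using \<sigma> by (subst nn_integral_real_affine[where c=\<sigma> and t=0]) auto
    also have "(\<integral>\<^sup>+ y. ennreal (w \<sigma> (\<sigma> * y) * (norm (F (\<sigma> * y)))\<^sup>2) \<partial>lborel)
       = (\<integral>\<^sup>+ y. ennreal (sqrt (2 * pi)) * (ennreal (std_normal_density y) * ennreal ((norm (F (\<sigma> * y)))\<^sup>2)) \<partial>lborel)"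
      using \<sigma> by (intro nn_integral_cong)
        (simp add: w_def std_normal_density_def flip: ennreal_mult)
    also have "\<dots> = ennreal (sqrt (2 * pi)) * (\<integral>\<^sup>+ y. ennreal ((norm (F (\<sigma> * y)))\<^sup>2) \<partial>std_normal_distribution)"
      by (subst nn_integral_density) (auto simp: nn_integral_cmult)
    also have "\<dots> \<le> ennreal (sqrt (2 * pi)) * (ennreal (1 / (\<sigma> * sqrt (2 * pi))) * ?R)"
      using extension_gaussian_L2_bound[OF Q _ _ _ B dens h \<sigma>]
      by (intro mult_left_mono) (auto simp: F_def mult.assoc)
    also have "ennreal \<sigma> * \<dots> = (ennreal \<sigma> * ennreal (sqrt (2 * pi)) * ennreal (1 / (\<sigma> * sqrt (2 * pi)))) * ?R"
      by (simp only: mult.assoc)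
    \<comment> \<open>The Jacobian of the substitution and the normalisation of the normal density
      cancel the kernel mass exactly.\<close>
    also have "ennreal \<sigma> * ennreal (sqrt (2 * pi)) * ennreal (1 / (\<sigma> * sqrt (2 * pi))) = 1"
      using \<sigma> by (simp flip: ennreal_mult)
    finally show ?thesis by (simp add: mult_left_mono)
  qed
  have lim: "(\<lambda>n. ennreal (w (Suc n) x * (norm (F x))\<^sup>2)) \<longlonglongrightarrow> ennreal ((norm (F x))\<^sup>2)" for x
  proof -
    have "(\<lambda>n. x / real (Suc n)) \<longlonglongrightarrow> 0"
      by (intro real_tendsto_divide_at_top[OF tendsto_const] filterlim_compose[OF filterlim_real_sequentially filterlim_Suc])
    then have "(\<lambda>n. w (Suc n) x * (norm (F x))\<^sup>2) \<longlonglongrightarrow> exp (- 0\<^sup>2 / 2) * (norm (F x))\<^sup>2"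
      unfolding w_def by (intro tendsto_intros) auto
    then show ?thesis by (intro tendsto_ennrealI) simp
  qed
  \<comment> \<open>Fatou along the widths \<open>Suc n\<close>, which are positive as
    \<open>le\<close> requires.\<close>
  have "(\<integral>\<^sup>+ x. ennreal ((norm (F x))\<^sup>2) \<partial>lborel)
      = (\<integral>\<^sup>+ x. liminf (\<lambda>n. ennreal (w (Suc n) x * (norm (F x))\<^sup>2)) \<partial>lborel)"
    by (intro nn_integral_cong lim_imp_Liminf[symmetric] lim) simp
  also have "\<dots> \<le> liminf (\<lambda>n. \<integral>\<^sup>+ x. ennreal (w (Suc n) x * (norm (F x))\<^sup>2) \<partial>lborel)"
    by (rule nn_integral_liminf) measurable
  also have "\<dots> \<le> ?R"
    by (rule order_trans[OF Liminf_le_Limsup Limsup_bounded]) (auto intro!: always_eventually le)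
  finally show ?thesis .
qed


section \<open>The L^4 bound for the extension operator and its pairing with f\<close>

text \<open>The L^2 bound is applied on \<open>\<mu> \<Otimes>\<^sub>M \<mu>\<close> with
  \<open>\<phi>\<close> the addition map, whose law is \<open>convolution \<mu> \<mu>\<close>, and
  with \<open>G\<close> the tensor square of \<open>g\<close>. Then \<open>F\<close> is
  \<open>H\<^sup>2\<close>, and the L^2 integral of \<open>G\<close> factorises.\<close>

lemma extension_L4_bound:
  fixes \<mu> :: "real measure" and g :: "real \<Rightarrow> complex" and M B :: real
  assumes \<mu>: "prob_space \<mu>" and sets: "sets \<mu> = sets borel"
    and [measurable]: "g \<in> borel_measurable borel" "h \<in> borel_measurable lborel"
    and B: "\<And>z. norm (g z) \<le> B"
    and dens: "convolution \<mu> \<mu> = density lborel h"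
    and h: "AE x in lborel. h x \<le> ennreal M"
  defines "H \<equiv> \<lambda>x. LINT a|\<mu>. g a * cis (- (2 * pi * a * x))"
  shows "(\<integral>\<^sup>+ x. ennreal ((norm (H x)) ^ 4) \<partial>lborel) \<le> ennreal M * (\<integral>\<^sup>+ a. ennreal ((norm (g a))\<^sup>2) \<partial>\<mu>)\<^sup>2"
proof -
  interpret prob_space \<mu> by fact
  interpret PP: pair_prob_space \<mu> \<mu> ..
  have [measurable_cong]: "sets \<mu> = sets borel" by fact
  have B0: "0 \<le> B" using B order_trans norm_ge_zero by blast
  define G where "G z = g (fst z) * g (snd z)" for z
  have G: "norm (G z) \<le> B * B" for z
    unfolding G_def using mult_mono[OF B B] B0 by (simp add: norm_mult)
  have Gm [measurable]: "G \<in> borel_measurable (\<mu> \<Otimes>\<^sub>M \<mu>)"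
    unfolding G_def by measurable
  have square: "(LINT z|(\<mu> \<Otimes>\<^sub>M \<mu>). G z * cis (- (2 * pi * (fst z + snd z) * x))) = (H x)\<^sup>2" for x
  proof -
    let ?k = "\<lambda>a. g a * cis (- (2 * pi * a * x))"
    have "(LINT z|(\<mu> \<Otimes>\<^sub>M \<mu>). G z * cis (- (2 * pi * (fst z + snd z) * x)))
        = (LINT z|(\<mu> \<Otimes>\<^sub>M \<mu>). ?k (fst z) * ?k (snd z))"
      unfolding G_def by (intro Bochner_Integration.integral_cong refl)
        (simp add: mult.assoc mult.left_commute[of "cis _" "g _"] cis_mult, simp add: algebra_simps)
    also have "\<dots> = (LINT a|\<mu>. LINT b|\<mu>. ?k a * ?k b)"
      by (subst PP.integral_fst'[symmetric])
        (use mult_mono[OF B B] B0 in \<open>auto simp: norm_mult intro!: PP.P.integrable_const_bound[where B="B * B"]\<close>)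
    also have "\<dots> = (H x)\<^sup>2"
      by (simp add: H_def power2_eq_square)
    finally show ?thesis .
  qed
  have "distr (\<mu> \<Otimes>\<^sub>M \<mu>) borel (\<lambda>z. fst z + snd z) = density lborel h"
    using dens by (simp add: convolution_def case_prod_beta')
  from extension_L2_bound[OF PP.prob_space_axioms _ Gm _ G this h]
  have "(\<integral>\<^sup>+ x. ennreal ((norm ((H x)\<^sup>2))\<^sup>2) \<partial>lborel)
      \<le> ennreal M * (\<integral>\<^sup>+ z. ennreal ((norm (G z))\<^sup>2) \<partial>(\<mu> \<Otimes>\<^sub>M \<mu>))"
    unfolding square by simp
  also have "(\<integral>\<^sup>+ z. ennreal ((norm (G z))\<^sup>2) \<partial>(\<mu> \<Otimes>\<^sub>M \<mu>))
      = (\<integral>\<^sup>+ a. \<integral>\<^sup>+ b. ennreal ((norm (g a))\<^sup>2) * ennreal ((norm (g b))\<^sup>2) \<partial>\<mu> \<partial>\<mu>)"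
    by (subst nn_integral_fst[symmetric])
      (auto simp: G_def norm_mult power_mult_distrib ennreal_mult)
  also have "\<dots> = (\<integral>\<^sup>+ a. ennreal ((norm (g a))\<^sup>2) \<partial>\<mu>)\<^sup>2"
    by (simp add: nn_integral_cmult nn_integral_multc power2_eq_square)
  finally show ?thesis by (simp add: norm_power flip: power_mult)
qed

text \<open>Young's inequality stands in for the duality of \<open>L\<^sup>p\<close> and \<open>L\<^sup>q\<close>, \<open>q = p / (p - 1) \<ge> 4\<close>; the
  \<open>q\<close>-th powers are reduced to fourth powers by \<open>\<bar>H\<bar> \<le> N\<close>.\<close>

lemma pairing_bound:
  fixes f H :: "real \<Rightarrow> complex" and p A M N :: real
  assumes [measurable]: "f \<in> borel_measurable borel" "H \<in> borel_measurable borel"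
    and p: "1 < p" "p \<le> 4 / 3"
    and A: "0 < A" "(\<integral>\<^sup>+ x. ennreal (norm (f x) powr p) \<partial>lborel) = ennreal (A powr p)"
    and N: "0 < N" "\<And>x. norm (H x) \<le> N"
    and M: "1 \<le> M" "(\<integral>\<^sup>+ x. ennreal (norm (H x) ^ 4) \<partial>lborel) \<le> ennreal (M * N ^ 4)"
  shows "(\<integral>\<^sup>+ x. ennreal (norm (f x) * norm (H x)) \<partial>lborel) \<le> ennreal (M * A * N)"
proof -
  define q where "q = p / (p - 1)"
  have q: "1 < q" "4 \<le> q" "1 / p + 1 / q = 1"
    using p by (auto simp: q_def field_simps)
  let ?u = "\<lambda>x. norm (f x) / A" and ?v = "\<lambda>x. norm (H x) / N"
  \<comment> \<open>These constants arise when Young's inequality for the normalised functions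
    \<open>?u\<close> and \<open>?v\<close> is multiplied by \<open>A * N\<close>.\<close>
  let ?a = "A * N / p / A powr p" and ?b = "A * N / q / N ^ 4"
  have ab: "0 \<le> ?a" "0 \<le> ?b" using A N p q by auto
  have young: "norm (f x) * norm (H x) \<le> ?a * norm (f x) powr p + ?b * norm (H x) ^ 4" for x
  proof -
    have "?u x * ?v x \<le> ?u x powr p / p + ?v x powr q / q"
      using p q A N by (intro Youngs_inequality) auto
    also have "?v x powr q \<le> ?v x powr 4"
      using q N by (intro powr_mono') auto
    also have "?v x powr 4 = ?v x ^ 4"
      using N powr_numeral[of "?v x" "num.Bit0 (num.Bit0 num.One)"] by simp
    finally have "?u x * ?v x \<le> ?u x powr p / p + ?v x ^ 4 / q"
      using q by (simp add: divide_right_mono)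
    from mult_left_mono[OF this, of "A * N"] show ?thesis
      using A N by (simp add: powr_divide power_divide field_simps)
  qed
  have "(\<integral>\<^sup>+ x. ennreal (norm (f x) * norm (H x)) \<partial>lborel)
      \<le> (\<integral>\<^sup>+ x. ennreal ?a * ennreal (norm (f x) powr p) + ennreal ?b * ennreal (norm (H x) ^ 4) \<partial>lborel)"
    using ab by (intro nn_integral_mono order_trans[OF ennreal_leI[OF young]])
      (simp only: ennreal_plus ennreal_mult' mult_nonneg_nonneg powr_ge_zero zero_le_power norm_ge_zero order_refl)
  also have "\<dots> = ennreal ?a * ennreal (A powr p) + ennreal ?b * (\<integral>\<^sup>+ x. ennreal (norm (H x) ^ 4) \<partial>lborel)"
    by (simp add: nn_integral_add nn_integral_cmult A)
  also have "\<dots> \<le> ennreal ?a * ennreal (A powr p) + ennreal ?b * ennreal (M * N ^ 4)"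
    by (intro add_left_mono mult_left_mono M) simp
  also have "\<dots> = ennreal (?a * A powr p + ?b * (M * N ^ 4))"
    using ab M N by (simp only: ennreal_plus ennreal_mult' mult_nonneg_nonneg powr_ge_zero zero_le_power order.trans[OF zero_le_one] less_imp_le)
  also have "\<dots> \<le> ennreal (M * A * N)"
  proof (rule ennreal_leI)
    have "?a * A powr p + ?b * (M * N ^ 4) = A * N * (1 / p + M / q)"
      using A N by (simp add: field_simps)
    \<comment> \<open>\<open>1 \<le> M\<close> lets \<open>M\<close> be factored out, after which
      \<open>1 / p + 1 / q = 1\<close>.\<close>
    also have "\<dots> \<le> A * N * (M * (1 / p + 1 / q))"
      using A N M p by (intro mult_left_mono) (auto simp: field_simps)
    finally show "?a * A powr p + ?b * (M * N ^ 4) \<le> M * A * N"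
      using q by (simp add: mult_ac)
  qed
  finally show ?thesis .
qed

section \<open>Schwartz functions and elementary bounds for the Fourier transform\<close>

lemma schwartz_space_measurable:
  assumes "f \<in> schwartz_space"
  shows "f \<in> borel_measurable borel"
proof (rule borel_measurable_continuous_onI)
  have "iterated_deriv 0 f differentiable (at x)" for x
    using assms unfolding schwartz_space_def by blast
  then show "continuous_on UNIV f"
    by (auto simp: iterated_deriv_def continuous_on_eq_continuous_at intro: differentiable_imp_continuous_within)
qed

text \<open>The seminorms with \<open>m = 0\<close> and \<open>m = 2\<close> dominate
  \<open>f\<close> by a multiple of the integrable function
  \<open>inverse (1 + x\<^sup>2)\<close>.\<close>

lemma schwartz_space_integrable:
  assumes f: "f \<in> schwartz_space"
  shows "integrable lborel f"
proof -
  have bdd: "bounded (range (\<lambda>x. x ^ m *\<^sub>R iterated_deriv 0 f x))" for m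
    using f unfolding schwartz_space_def by blast
  obtain a where a: "\<And>x. norm (f x) \<le> a"
    using bdd[of 0] by (auto simp: bounded_iff iterated_deriv_def)
  obtain b where b: "\<And>x. x\<^sup>2 * norm (f x) \<le> b"
    using bdd[of 2] by (auto simp: bounded_iff iterated_deriv_def)
  have "integrable lborel (\<lambda>x::real. inverse (1 + x\<^sup>2))"
    using integrable_inverse_1_plus_square by (simp add: set_integrable_def)
  then have "integrable lborel (\<lambda>x::real. (a + b) * inverse (1 + x\<^sup>2))"
    by simp
  then show ?thesis
  proof (rule Bochner_Integration.integrable_bound)
    show "f \<in> borel_measurable lborel"
      using schwartz_space_measurable[OF f] by simp
    have "norm (f x) \<le> (a + b) * inverse (1 + x\<^sup>2)" for x
    proof -
      have "norm (f x) * (1 + x\<^sup>2) \<le> a + b"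
        using a[of x] b[of x] by (simp add: algebra_simps)
      then show ?thesis
        by (simp add: divide_simps add_pos_nonneg)
    qed
    then show "AE x in lborel. norm (f x) \<le> norm ((a + b) * inverse (1 + x\<^sup>2))"
      by (intro AE_I2) (smt (verit) real_norm_def)
  qed
qed

lemma fourier_transform_cis:
  "fourier_transform f \<xi> = (LINT x|lborel. f x * cis (- (2 * pi * \<xi> * x)))"
  unfolding fourier_transform_def cis_conv_exp by (simp add: mult_ac)


lemma norm_fourier_transform_le: "norm (fourier_transform f \<xi>) \<le> (LINT x|lborel. norm (f x))"
  unfolding fourier_transform_cis by (rule order_trans[OF integral_norm_bound]) (simp add: norm_mult)

section \<open>Duality and the restriction estimate for integrable functions\<close>

text \<open>In \<open>cnj (fourier_transform f \<xi>) * fourier_transform f \<xi>\<close> the second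
  factor is expanded as an integral over \<open>x\<close>. Exchanging the integrals gives the
  integral of \<open>f x * H x\<close>, where \<open>H\<close> is the extension operator applied to
  the conjugate of the Fourier transform.\<close>

lemma restriction_duality:
  fixes f :: "real \<Rightarrow> complex"
  assumes \<mu>: "prob_space \<mu>" and sets: "sets \<mu> = sets borel"
    and f: "integrable lborel f"
  defines "H \<equiv> \<lambda>x. LINT \<xi>|\<mu>. cnj (fourier_transform f \<xi>) * cis (- (2 * pi * \<xi> * x))"
  shows "ennreal (LINT \<xi>|\<mu>. (norm (fourier_transform f \<xi>))\<^sup>2)
    \<le> (\<integral>\<^sup>+ x. ennreal (norm (f x) * norm (H x)) \<partial>lborel)"
proof -
  interpret prob_space \<mu> by fact
  interpret P: pair_sigma_finite lborel \<mu> ..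
  have [measurable_cong]: "sets \<mu> = sets borel" by fact
  have [measurable]: "f \<in> borel_measurable borel"
    using borel_measurable_integrable[OF f] by simp
  have FT [measurable]: "fourier_transform f \<in> borel_measurable borel"
    unfolding fourier_transform_cis[abs_def] by measurable
  have Hm [measurable]: "H \<in> borel_measurable borel"
    unfolding H_def by measurable
  have bd: "norm (fourier_transform f \<xi>) \<le> (LINT x|lborel. norm (f x))" for \<xi>
    by (rule norm_fourier_transform_le)
  let ?g = "\<lambda>\<xi>. cnj (fourier_transform f \<xi>)"
  let ?k = "\<lambda>x \<xi>. f x * (?g \<xi> * cis (- (2 * pi * \<xi> * x)))"
  have g: "integrable \<mu> (\<lambda>\<xi>. norm (fourier_transform f \<xi>))"
    by (rule integrable_const_bound[where B="LINT x|lborel. norm (f x)"]) (auto simp: bd)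
  have gk: "integrable \<mu> (\<lambda>\<xi>. ?g \<xi> * cis (- (2 * pi * \<xi> * x)))" for x
    by (rule integrable_const_bound[where B="LINT x|lborel. norm (f x)"]) (auto simp: bd norm_mult)
  \<comment> \<open>Fubini is justified by \<open>f\<close> being integrable, its transform bounded
    and \<open>\<mu>\<close> finite.\<close>
  have int: "integrable (lborel \<Otimes>\<^sub>M \<mu>) (case_prod ?k)"
    by (rule P.Fubini_integrable) (use f g gk in \<open>auto simp: norm_mult\<close>)
  have fH: "(LINT \<xi>|\<mu>. ?k x \<xi>) = f x * H x" for x
    by (simp add: H_def)
  have fHint: "integrable lborel (\<lambda>x. f x * H x)"
    using P.integrable_fst'[OF int] by (simp add: H_def)
  have "complex_of_real (LINT \<xi>|\<mu>. (norm (fourier_transform f \<xi>))\<^sup>2)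
      = (LINT \<xi>|\<mu>. ?g \<xi> * fourier_transform f \<xi>)"
    unfolding integral_complex_of_real[symmetric] complex_norm_square by (simp add: mult.commute)
  also have "\<dots> = (LINT \<xi>|\<mu>. LINT x|lborel. ?k x \<xi>)"
    unfolding fourier_transform_cis
    by (intro Bochner_Integration.integral_cong refl, subst integral_mult_right_zero[symmetric])
      (simp add: mult_ac)
  also have "\<dots> = (LINT x|lborel. f x * H x)"
    unfolding fH[symmetric] by (rule P.Fubini_integral[OF int])
  finally have eq: "complex_of_real (LINT \<xi>|\<mu>. (norm (fourier_transform f \<xi>))\<^sup>2) = \<dots>" .
  have "(LINT \<xi>|\<mu>. (norm (fourier_transform f \<xi>))\<^sup>2) = norm (LINT x|lborel. f x * H x)"
    unfolding eq[symmetric] norm_of_real by simp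
  then show ?thesis
    using integral_norm_bound_ennreal[OF fHint] by (simp add: norm_mult)
qed

lemma (in prob_space) expectation_le_sqrt:
  fixes X :: "'a \<Rightarrow> real"
  assumes "integrable M X" "integrable M (\<lambda>x. (X x)\<^sup>2)"
  shows "expectation X \<le> sqrt (expectation (\<lambda>x. (X x)\<^sup>2))"
proof (rule real_le_rsqrt)
  have "0 \<le> variance X" by simp
  then show "(expectation X)\<^sup>2 \<le> expectation (\<lambda>x. (X x)\<^sup>2)"
    using variance_eq[OF assms] by simp
qed

text \<open>With \<open>N\<close> the L^2(\<mu>) norm of the transform, duality and the pairing
  bound give \<open>N\<^sup>2 \<le> M * A * N\<close>, and \<open>N\<close> cancels.\<close>

lemma restriction_estimate:
  fixes \<mu> :: "real measure" and f :: "real \<Rightarrow> complex" and M p A :: real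
  assumes \<mu>: "prob_space \<mu>" and sets: "sets \<mu> = sets borel"
    and hm: "h \<in> borel_measurable lborel"
    and dens: "convolution \<mu> \<mu> = density lborel h"
    and h: "AE x in lborel. h x \<le> ennreal M"
    and M: "1 \<le> M" and p: "1 \<le> p" "p \<le> 4 / 3"
    and f: "integrable lborel f" and fm [measurable]: "f \<in> borel_measurable borel"
    and A: "0 \<le> A" "(\<integral>\<^sup>+ x. ennreal (norm (f x) powr p) \<partial>lborel) = ennreal (A powr p)"
  shows "sqrt (LINT \<xi>|\<mu>. (norm (fourier_transform f \<xi>))\<^sup>2) \<le> M * A"
proof -
  interpret prob_space \<mu> by fact
  have [measurable_cong]: "sets \<mu> = sets borel" by fact
  have FT [measurable]: "fourier_transform f \<in> borel_measurable borel"
    unfolding fourier_transform_cis[abs_def] by measurable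
  define L where "L = (LINT x|lborel. norm (f x))"
  have bd: "norm (fourier_transform f \<xi>) \<le> L" for \<xi>
    unfolding L_def by (rule norm_fourier_transform_le)
  have L0: "0 \<le> L" unfolding L_def by simp
  define N where "N = sqrt (LINT \<xi>|\<mu>. (norm (fourier_transform f \<xi>))\<^sup>2)"
  have N0: "0 \<le> N" by (simp add: N_def)
  have N2: "N\<^sup>2 = (LINT \<xi>|\<mu>. (norm (fourier_transform f \<xi>))\<^sup>2)"
    by (simp add: N_def)
  have int1: "integrable \<mu> (\<lambda>\<xi>. norm (fourier_transform f \<xi>))"
    by (rule integrable_const_bound[where B=L]) (auto simp: bd)
  have int2: "integrable \<mu> (\<lambda>\<xi>. (norm (fourier_transform f \<xi>))\<^sup>2)"
    by (rule integrable_const_bound[where B="L\<^sup>2"]) (auto intro!: power_mono bd)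
  have NL: "N \<le> L"
    unfolding N_def
    by (intro real_le_lsqrt L0 integral_le_const int2) (auto intro!: power_mono bd)
  have "N \<le> M * A"
  \<comment> \<open>The normalisation in \<open>pairing_bound\<close> needs \<open>1 < p\<close>,
    \<open>0 < A\<close> and \<open>0 < N\<close>. Otherwise the trivial bound
    \<open>N \<le> L\<close> suffices: \<open>L \<le> A\<close> if \<open>p = 1\<close>, while
    \<open>f\<close> vanishes almost everywhere if \<open>A = 0\<close>.\<close>
  proof (cases "p = 1 \<or> A = 0 \<or> N = 0")
    case True
    have *: "L \<le> A" if "p = 1"
      using A that f by (simp add: L_def nn_integral_eq_integral)
    have **: "L = 0" if "A = 0"
    proof -
      have "(\<integral>\<^sup>+ x. ennreal (norm (f x) powr p) \<partial>lborel) = 0"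
        using A that by simp
      then have "AE x in lborel. f x = 0"
        by (subst (asm) nn_integral_0_iff_AE) (auto elim!: eventually_mono)
      then have "L = (LINT x|(lborel :: real measure). (0::real))"
        unfolding L_def by (intro integral_cong_AE) auto
      then show ?thesis by simp
    qed
    have "A \<le> M * A" using M A by (simp add: mult_le_cancel_right1)
    then show ?thesis using True * ** NL A M by auto
  next
    case False
    then have pos: "1 < p" "0 < A" "0 < N" using p A N0 by auto
    define H where "H = (\<lambda>x. LINT \<xi>|\<mu>. cnj (fourier_transform f \<xi>) * cis (- (2 * pi * \<xi> * x)))"
    have Hm: "H \<in> borel_measurable borel"
      unfolding H_def by measurable
    \<comment> \<open>Cauchy-Schwarz against the constant 1, in the form of nonnegative variance
      under the probability measure \<open>\<mu>\<close>.\<close>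
    have HN: "norm (H x) \<le> N" for x
    proof -
      have "norm (H x) \<le> (LINT \<xi>|\<mu>. norm (fourier_transform f \<xi>))"
        unfolding H_def by (rule order_trans[OF integral_norm_bound]) (simp add: norm_mult)
      also have "\<dots> \<le> N"
        unfolding N_def by (rule expectation_le_sqrt[OF int1 int2])
      finally show ?thesis .
    qed
    have "(\<integral>\<^sup>+ x. ennreal (norm (H x) ^ 4) \<partial>lborel)
        \<le> ennreal M * (\<integral>\<^sup>+ \<xi>. ennreal ((norm (cnj (fourier_transform f \<xi>)))\<^sup>2) \<partial>\<mu>)\<^sup>2"
      unfolding H_def by (rule extension_L4_bound[OF \<mu> sets _ hm _ dens h, where B=L]) (auto simp: bd)
    also have "\<dots> = ennreal (M * N ^ 4)"
      using M by (simp add: nn_integral_eq_integral[OF int2] ennreal_power ennreal_mult flip: N2 power_mult)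
    finally have H4: "(\<integral>\<^sup>+ x. ennreal (norm (H x) ^ 4) \<partial>lborel) \<le> ennreal (M * N ^ 4)" .
    have "ennreal (N\<^sup>2) \<le> (\<integral>\<^sup>+ x. ennreal (norm (f x) * norm (H x)) \<partial>lborel)"
      unfolding N2 H_def by (rule restriction_duality[OF \<mu> sets f])
    also have "\<dots> \<le> ennreal (M * A * N)"
      by (rule pairing_bound[OF fm Hm pos(1) p(2) pos(2) A(2) pos(3) HN M H4])
    finally have "N * N \<le> M * A * N"
      using M A N0 by (simp add: power2_eq_square)
    then show ?thesis using pos by simp
  qed
  then show ?thesis by (simp add: N_def)
qed

section \<open>The estimate for Schwartz functions and the choice of the constant\<close>

theorem corollary1:
  fixes \<mu> :: "real measure"
  assumes "prob_space \<mu>"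
    and "sets \<mu> = sets borel"
    and "has_Linfty_density (convolution \<mu> \<mu>)"
  shows "\<forall>p::real. 1 \<le> p \<and> p \<le> 4 / 3 \<longrightarrow>
           (\<exists>C::real. C > 0 \<and>
              (\<forall>f\<in>schwartz_space.
                 Lp_norm \<mu> 2 (fourier_transform f) \<le> ennreal C * Lp_norm lborel p f))"
proof (intro allI impI)
  fix p :: real
  assume p: "1 \<le> p \<and> p \<le> 4 / 3"
  interpret prob_space \<mu> by fact
  have [measurable_cong]: "sets \<mu> = sets borel" by fact
  obtain h :: "real \<Rightarrow> ennreal" where h: "h \<in> borel_measurable lborel" "esssup lborel h < \<infinity>"
      "convolution \<mu> \<mu> = density lborel h"
    using assms(3) unfolding has_Linfty_density_def by blast
  \<comment> \<open>This is the final constant \<open>C\<close>, the same for all \<open>p\<close>.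
    The maximum with 1 makes it positive and meets the condition \<open>1 \<le> M\<close> of
    \<open>pairing_bound\<close>.\<close>
  define M where "M = max 1 (enn2real (esssup lborel h))"
  have "esssup lborel h = ennreal (enn2real (esssup lborel h))"
    using h(2) by (simp add: ennreal_enn2real_if less_top)
  also have "\<dots> \<le> ennreal M"
    by (intro ennreal_leI) (simp add: M_def)
  finally have hM: "AE x in lborel. h x \<le> ennreal M"
    using esssup_AE[of h lborel] by (auto elim!: eventually_mono intro: order_trans)
  have M: "1 \<le> M" by (simp add: M_def)
  have "Lp_norm \<mu> 2 (fourier_transform f) \<le> ennreal M * Lp_norm lborel p f" if f: "f \<in> schwartz_space" for f
  proof -
    have [measurable]: "f \<in> borel_measurable borel" 
      by (rule schwartz_space_measurable[OF f])
    have FT [measurable]: "fourier_transform f \<in> borel_measurable borel"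
      unfolding fourier_transform_cis[abs_def] by measurable
    have "integrable \<mu> (\<lambda>\<xi>. (norm (fourier_transform f \<xi>))\<^sup>2)"
      by (rule integrable_const_bound[where B="(LINT x|lborel. norm (f x))\<^sup>2"])
        (auto intro!: power_mono norm_fourier_transform_le)
    then have L2: "Lp_norm \<mu> 2 (fourier_transform f)
        = ennreal (sqrt (LINT \<xi>|\<mu>. (norm (fourier_transform f \<xi>))\<^sup>2))"
      by (simp add: Lp_norm_def Let_def nn_integral_eq_integral powr_half_sqrt)
    define I where "I = (\<integral>\<^sup>+ x. ennreal (norm (f x) powr p) \<partial>lborel)"
    show ?thesis
    \<comment> \<open>An infinite \<open>I\<close> makes the right-hand side infinite, so the p-th
      power integrability of \<open>f\<close> need not be proved.\<close>
    proof (cases "I = \<infinity>")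
      case True
      then have "ennreal M * Lp_norm lborel p f = \<infinity>"
        using M by (simp add: Lp_norm_def Let_def I_def ennreal_mult_top)
      then show ?thesis by simp
    next
      case False
      define A where "A = enn2real I powr (1 / p)"
      have "I = ennreal (A powr p)"
        using False p by (simp add: A_def powr_powr ennreal_enn2real_if)
      then have "sqrt (LINT \<xi>|\<mu>. (norm (fourier_transform f \<xi>))\<^sup>2) \<le> M * A"
        using p by (intro restriction_estimate[OF assms(1,2) h(1,3) hM M _ _ schwartz_space_integrable[OF f]])
          (auto simp: A_def I_def)
      moreover have "Lp_norm lborel p f = ennreal A"
        using False by (simp add: Lp_norm_def Let_def I_def A_def)
      ultimately show ?thesis
        using M by (simp add: L2 ennreal_leI flip: ennreal_mult')
    qed
  qed
  then show "\<exists>C::real. C > 0 \<and>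
              (\<forall>f\<in>schwartz_space.
                 Lp_norm \<mu> 2 (fourier_transform f) \<le> ennreal C * Lp_norm lborel p f)"
    using M by (intro exI[of _ M]) auto
qed

end
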